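(* Let $\mathcal{S}:(\mathbb{R},\leq)\to \mathbf{DGI}$ be a functor (a persistence differential graded inner product space). Then there is a natural isomorphism $h\mathcal{S}\Rightarrow H\mathcal{S}$ of functors from $(\mathbb{R},\leq)$ to $\mathbf{Inn}$, where $h,H:\mathbf{DGI}\to\mathbf{Inn}$ are the harmonic space functor and the homology functor.
   Context: All vector spaces are real. A differential graded inner product space is a finite-dimensional graded vector space $V=\bigoplus_p V_p$ with a differential $d:V_p\to V_{p-1}$, $d^2=0$, and an inner product $\langle\cdot,\cdot\rangle$ such that $V_i\perp V_j$ for $i\neq j$. A morphism $f:V\to W$ of such spaces is a (degree-preserving) chain map with $\langle x,y\rangle_V=\langle f(x),f(y)\rangle_W$ for all $x,y\in V$. $\mathbf{DGI}$ is the resulting category. $\mathbf{Inn}$ is the category of inner product spaces and linear maps. $(\mathbb{R},\leq)$ is the poset of real numbers regarded as a category, with a unique morphism $a\to b$ whenever $a\leq b$. For $V\in\mathbf{DGI}$ let $d^*$ be the adjoint of $d$. One has the orthogonal Hodge decomposition $V=dV\oplus d^*V\oplus\mathcal{H}$ with $\mathcal{H}=\ker d\cap\ker d^*$. Let $h=h_V:V\to V$ be the orthogonal projection onto $\mathcal{H}$, so $h(V)=\mathcal{H}$. The harmonic space functor $h:\mathbf{DGI}\to\mathbf{Inn}$ sends $V$ to $h(V)$ and $f:V\to W$ to $h(f):h(V)\to h(W)$, $x\mapsto h_W(f(x))$. The homology functor $H:\mathbf{DGI}\to\mathbf{Inn}$ sends $V$ to its homology $H(V)=\ker d/\operatorname{im}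 d$, with the inner product inherited from the harmonic space via $\mathcal{H}\cong H(V)$, $z\mapsto[z]$ (equivalently, the quotient inner product), and $f$ to the induced map $H(f)$. *)

theory Defs
  imports "Jordan_Normal_Form.VS_Connect" "HOL-Algebra.AbelCoset" "HOL-Library.FuncSet"
begin

section \<open>Categories and functors\<close>

record ('o, 'm) category =
  Ob :: "'o set"
  Hom :: "'o \<Rightarrow> 'o \<Rightarrow> 'm set"
  Id :: "'o \<Rightarrow> 'm"
  Comp :: "'o \<Rightarrow> 'o \<Rightarrow> 'o \<Rightarrow> 'm \<Rightarrow> 'm \<Rightarrow> 'm"

text \<open>Hom-sets need not be disjoint, so composition takes the objects as arguments:
  \<open>Comp C a b c g f\<close> is $g \circ f$ for $f : a \to b$ and $g : b \to c$.\<close>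

locale category =
  fixes C :: "('o, 'm) category"
  assumes Id_in_Hom: "a \<in> Ob C \<Longrightarrow> Id C a \<in> Hom C a a"
    and Comp_in_Hom: "\<lbrakk>a \<in> Ob C; b \<in> Ob C; c \<in> Ob C; f \<in> Hom C a b; g \<in> Hom C b c\<rbrakk>
      \<Longrightarrow> Comp C a b c g f \<in> Hom C a c"
    and Comp_Id: "\<lbrakk>a \<in> Ob C; b \<in> Ob C; f \<in> Hom C a b\<rbrakk> \<Longrightarrow> Comp C a a b f (Id C a) = f"
    and Id_Comp: "\<lbrakk>a \<in> Ob C; b \<in> Ob C; f \<in> Hom C a b\<rbrakk> \<Longrightarrow> Comp C a b b (Id C b) f = f"
    and Comp_assoc: "\<lbrakk>a \<in> Ob C; b \<in> Ob C; c \<in> Ob C; d \<in> Ob C;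
        f \<in> Hom C a b; g \<in> Hom C b c; h \<in> Hom C c d\<rbrakk>
      \<Longrightarrow> Comp C a c d h (Comp C a b c g f) = Comp C a b d (Comp C b c d h g) f"

record ('o, 'm, 'p, 'n) functor_data =
  omap :: "'o \<Rightarrow> 'p"
  fmap :: "'o \<Rightarrow> 'o \<Rightarrow> 'm \<Rightarrow> 'n"

locale is_functor = C: category C + D: category D
  for C :: "('o, 'm) category" and D :: "('p, 'n) category" +
  fixes F :: "('o, 'm, 'p, 'n) functor_data"
  assumes omap_in_Ob: "a \<in> Ob C \<Longrightarrow> omap F a \<in> Ob D"
    and fmap_in_Hom: "\<lbrakk>a \<in> Ob C; b \<in> Ob C; f \<in> Hom C a b\<rbrakk>
      \<Longrightarrow> fmap F a b f \<in> Hom D (omap F a) (omap F b)"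
    and fmap_Id: "a \<in> Ob C \<Longrightarrow> fmap F a a (Id C a) = Id D (omap F a)"
    and fmap_Comp: "\<lbrakk>a \<in> Ob C; b \<in> Ob C; c \<in> Ob C; f \<in> Hom C a b; g \<in> Hom C b c\<rbrakk>
      \<Longrightarrow> fmap F a c (Comp C a b c g f)
        = Comp D (omap F a) (omap F b) (omap F c) (fmap F b c g) (fmap F a b f)"

definition functor_comp ::
    "('p, 'n, 'q, 'k) functor_data \<Rightarrow> ('o, 'm, 'p, 'n) functor_data \<Rightarrow> ('o, 'm, 'q, 'k) functor_data"
    (infixr \<open>\<circ>\<^sub>F\<close> 55) where
  "G \<circ>\<^sub>F F = \<lparr>omap = (\<lambda>a. omap G (omap F a)),
     fmap = (\<lambda>a b f. fmap G (omap F a) (omap F b) (fmap F a b f))\<rparr>"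

text \<open>The poset $(\mathbb{R}, \le)$; the unique morphism $a \to b$ is \<open>()\<close>.\<close>

definition real_poset :: "(real, unit) category" where
  "real_poset = \<lparr>Ob = UNIV, Hom = (\<lambda>a b. {_. a \<le> b}), Id = (\<lambda>_. ()), Comp = (\<lambda>_ _ _ _ _. ())\<rparr>"

lemma category_real_poset: "category real_poset"
  by unfold_locales (auto simp: real_poset_def split: if_splits)


section \<open>Inner product spaces and the category Inn\<close>

abbreviation real_field :: "real ring" where
  "real_field \<equiv> class_ring"

text \<open>The fields \<open>mult\<close> and \<open>one\<close> inherited from \<^typ>\<open>'a ring\<close> carry no meaning here.\<close>

record 'a inner_space = "(real, 'a) module" +
  iprod :: "'a \<Rightarrow> 'a \<Rightarrow> real"

locale inner_product_space = vectorspace real_field V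
  for V :: "('a, 'z) inner_space_scheme" (structure) +
  assumes iprod_sym: "\<lbrakk>x \<in> carrier V; y \<in> carrier V\<rbrakk> \<Longrightarrow> iprod V x y = iprod V y x"
    and iprod_add: "\<lbrakk>x \<in> carrier V; y \<in> carrier V; z \<in> carrier V\<rbrakk>
      \<Longrightarrow> iprod V (x \<oplus> y) z = iprod V x z + iprod V y z"
    and iprod_smult: "\<lbrakk>x \<in> carrier V; y \<in> carrier V\<rbrakk> \<Longrightarrow> iprod V (r \<odot>\<^bsub>V\<^esub> x) y = r * iprod V x y"
    and iprod_pos: "\<lbrakk>x \<in> carrier V; x \<noteq> \<zero>\<rbrakk> \<Longrightarrow> iprod V x x > 0"

text \<open>Morphisms are represented by functions that are \<^const>\<open>undefined\<close> outside their domain,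
  so that equality of morphisms is equality of HOL functions. \<open>Inn_hom\<close> also covers spaces
  over different HOL types: no single HOL type carries all inner product spaces,
  so Inn is the family of the categories \<open>INN\<close>, one for each carrier type, together with the
  morphisms between them.\<close>

definition Inn_hom :: "('a, 'y) inner_space_scheme \<Rightarrow> ('b, 'z) inner_space_scheme \<Rightarrow> ('a \<Rightarrow> 'b) set" where
  "Inn_hom X Y = {f \<in> extensional (carrier X). linear_map real_field X Y f}"

definition INN :: "('a inner_space, 'a \<Rightarrow> 'a) category" where
  "INN = \<lparr>Ob = {X. inner_product_space X}, Hom = Inn_hom,
     Id = (\<lambda>X. \<lambda>x\<in>carrier X. x), Comp = (\<lambda>X Y Z g f. compose (carrier X) g f)\<rparr>"

lemma linear_map_compose:
  assumes "linear_map real_field X Y f" and "linear_map real_field Y Z g"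
  shows "linear_map real_field X Z (compose (carrier X) g f)"
proof -
  interpret f: linear_map real_field X Y f by fact
  interpret g: linear_map real_field Y Z g by fact
  have "compose (carrier X) g f \<in> LinearCombinations.module_hom real_field X Z"
    using f.f_hom g.f_hom by (auto simp: LinearCombinations.module_hom_def compose_def Pi_def)
  then show ?thesis
    by (intro linear_map.intro mod_hom.intro mod_hom_axioms.intro) unfold_locales
qed

lemma linear_map_id:
  assumes "vectorspace real_field X"
  shows "linear_map real_field X X (\<lambda>x\<in>carrier X. x)"
proof -
  interpret vectorspace real_field X by fact
  have "(\<lambda>x\<in>carrier X. x) \<in> LinearCombinations.module_hom real_field X X"
    by (auto simp: LinearCombinations.module_hom_def)
  then show ?thesis
    by (intro linear_map.intro mod_hom.intro mod_hom_axioms.intro) unfold_locales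
qed

lemma linear_map_closed:
  assumes "linear_map real_field X Y f" and "x \<in> carrier X"
  shows "f x \<in> carrier Y"
proof -
  interpret linear_map real_field X Y f by fact
  show ?thesis using f_hom assms(2) by (auto simp: LinearCombinations.module_hom_def)
qed

lemma category_INN: "category INN"
proof
  fix X Y Z W :: "'a inner_space" and f g h :: "'a \<Rightarrow> 'a"
  show "Id INN X \<in> Hom INN X X" if "X \<in> Ob INN"
    using that by (auto simp: INN_def Inn_hom_def inner_product_space_def intro: linear_map_id)
  show "Comp INN X Y Z g f \<in> Hom INN X Z" if "f \<in> Hom INN X Y" "g \<in> Hom INN Y Z"
    using that by (auto simp: INN_def Inn_hom_def intro: linear_map_compose)
  show "Comp INN X X Y f (Id INN X) = f" if "f \<in> Hom INN X Y"
    using that by (intro ext)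
      (auto simp: INN_def Inn_hom_def compose_def extensional_def)
  show "Comp INN X Y Y (Id INN Y) f = f" if "f \<in> Hom INN X Y"
    using that by (intro ext)
      (auto simp: INN_def Inn_hom_def compose_def extensional_def dest: linear_map_closed)
  show "Comp INN X Z W h (Comp INN X Y Z g f) = Comp INN X Y W (Comp INN Y Z W h g) f"
    if "f \<in> Hom INN X Y"
    using that by (intro ext)
      (auto simp: INN_def Inn_hom_def compose_def dest: linear_map_closed)
qed

definition Inn_iso :: "'a inner_space \<Rightarrow> 'b inner_space \<Rightarrow> ('a \<Rightarrow> 'b) \<Rightarrow> bool" where
  "Inn_iso X Y f \<longleftrightarrow> f \<in> Inn_hom X Y \<and>
     (\<exists>g \<in> Inn_hom Y X. compose (carrier X) g f = (\<lambda>x\<in>carrier X. x) \<and>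
                        compose (carrier Y) f g = (\<lambda>y\<in>carrier Y. y))"

definition Inn_natural_iso ::
    "('o, 'm) category \<Rightarrow> ('o, 'm, 'a inner_space, 'a \<Rightarrow> 'a) functor_data \<Rightarrow>
     ('o, 'm, 'b inner_space, 'b \<Rightarrow> 'b) functor_data \<Rightarrow> ('o \<Rightarrow> 'a \<Rightarrow> 'b) \<Rightarrow> bool" where
  "Inn_natural_iso C F G \<eta> \<longleftrightarrow>
     is_functor C INN F \<and> is_functor C INN G \<and>
     (\<forall>a \<in> Ob C. Inn_iso (omap F a) (omap G a) (\<eta> a)) \<and>
     (\<forall>a \<in> Ob C. \<forall>b \<in> Ob C. \<forall>f \<in> Hom C a b.
        compose (carrier (omap F a)) (\<eta> b) (fmap F a b f) =
        compose (carrier (omap F a)) (fmap G a b f) (\<eta> a))"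


section \<open>Differential graded inner product spaces\<close>

record 'a dg_space = "'a inner_space" +
  grade :: "int \<Rightarrow> 'a set"
  diff :: "'a \<Rightarrow> 'a"

locale dgi_space = inner_product_space V for V :: "('a, 'z) dg_space_scheme" (structure) +
  assumes fin_dim: fin_dim
    and grade_subspace: "VectorSpace.subspace real_field (grade V p) V"
    and direct_sum: "v \<in> carrier V \<Longrightarrow>
      \<exists>!c. (\<forall>p. c p \<in> grade V p) \<and> finite {p. c p \<noteq> \<zero>} \<and> v = (\<Oplus>p\<in>{p. c p \<noteq> \<zero>}. c p)"
    and grade_orthogonal: "\<lbrakk>i \<noteq> j; x \<in> grade V i; y \<in> grade V j\<rbrakk> \<Longrightarrow> iprod V x y = 0"
    and diff_linear: "linear_map real_field V V (diff V)"
    and diff_grade: "x \<in> grade V p \<Longrightarrow> diff V x \<in> grade V (p - 1)"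
    and diff_diff: "x \<in> carrier V \<Longrightarrow> diff V (diff V x) = \<zero>"

definition DGI_hom :: "'a dg_space \<Rightarrow> 'a dg_space \<Rightarrow> ('a \<Rightarrow> 'a) set" where
  "DGI_hom V W = {f \<in> extensional (carrier V). linear_map real_field V W f \<and>
     (\<forall>p. \<forall>x \<in> grade V p. f x \<in> grade W p) \<and>
     (\<forall>x \<in> carrier V. f (diff V x) = diff W (f x)) \<and>
     (\<forall>x \<in> carrier V. \<forall>y \<in> carrier V. iprod V x y = iprod W (f x) (f y))}"

definition DGI :: "('a dg_space, 'a \<Rightarrow> 'a) category" where
  "DGI = \<lparr>Ob = {V. dgi_space V}, Hom = DGI_hom,
     Id = (\<lambda>V. \<lambda>x\<in>carrier V. x), Comp = (\<lambda>U V W g f. compose (carrier U) g f)\<rparr>"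

lemma category_DGI: "category DGI"
proof
  fix X Y Z W :: "'a dg_space" and f g h :: "'a \<Rightarrow> 'a"
  have sub: "x \<in> carrier V" if "dgi_space V" "x \<in> grade V p" for V :: "'a dg_space" and x p
  proof -
    interpret dgi_space V by fact
    show ?thesis using grade_subspace[of p] that(2)
      by (auto simp: VectorSpace.subspace_def submodule_def)
  qed
  have vs: "vectorspace real_field V" and d: "x \<in> carrier V \<Longrightarrow> diff V x \<in> carrier V"
    if "dgi_space V" for V :: "'a dg_space" and x
  proof -
    interpret dgi_space V by fact
    show "vectorspace real_field V" by unfold_locales
    show "x \<in> carrier V \<Longrightarrow> diff V x \<in> carrier V" by (rule linear_map_closed[OF diff_linear])
  qed
  show "Id DGI X \<in> Hom DGI X X" if "X \<in> Ob DGI"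
    using that by (auto simp: DGI_def DGI_hom_def intro: linear_map_id vs dest: sub d)
  show "Comp DGI X Y Z g f \<in> Hom DGI X Z"
    if "X \<in> Ob DGI" "Y \<in> Ob DGI" "f \<in> Hom DGI X Y" "g \<in> Hom DGI Y Z"
  proof -
    have "f x \<in> carrier Y" "diff X x \<in> carrier X" if "x \<in> carrier X" for x
      using that \<open>X \<in> Ob DGI\<close> \<open>f \<in> Hom DGI X Y\<close>
      by (auto simp: DGI_def DGI_hom_def intro: linear_map_closed d)
    then show ?thesis
      using that by (auto simp: DGI_def DGI_hom_def compose_eq intro!: linear_map_compose dest: sub)
  qed
  show "Comp DGI X X Y f (Id DGI X) = f" if "f \<in> Hom DGI X Y"
    using that by (intro ext)
      (auto simp: DGI_def DGI_hom_def compose_def extensional_def)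
  show "Comp DGI X Y Y (Id DGI Y) f = f" if "f \<in> Hom DGI X Y"
    using that by (intro ext)
      (auto simp: DGI_def DGI_hom_def compose_def extensional_def dest: linear_map_closed)
  show "Comp DGI X Z W h (Comp DGI X Y Z g f) = Comp DGI X Y W (Comp DGI Y Z W h g) f"
    if "f \<in> Hom DGI X Y"
    using that by (intro ext)
      (auto simp: DGI_def DGI_hom_def compose_def dest: linear_map_closed)
qed


section \<open>The harmonic space functor\<close>

definition adjoint_map :: "('a, 'z) inner_space_scheme \<Rightarrow> ('a \<Rightarrow> 'a) \<Rightarrow> 'a \<Rightarrow> 'a" where
  "adjoint_map V T y = (THE z. z \<in> carrier V \<and> (\<forall>x \<in> carrier V. iprod V (T x) y = iprod V x z))"

definition orthogonal_projection :: "('a, 'z) inner_space_scheme \<Rightarrow> 'a set \<Rightarrow> 'a \<Rightarrow> 'a" where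
  "orthogonal_projection V U x = (THE u. u \<in> U \<and> (\<forall>w \<in> U. iprod V (x \<ominus>\<^bsub>V\<^esub> u) w = 0))"

definition harmonic :: "'a dg_space \<Rightarrow> 'a set" where
  "harmonic V = {x \<in> carrier V. diff V x = \<zero>\<^bsub>V\<^esub> \<and> adjoint_map V (diff V) x = \<zero>\<^bsub>V\<^esub>}"

definition harmonic_space :: "'a dg_space \<Rightarrow> 'a inner_space" where
  "harmonic_space V = inner_space.truncate (V\<lparr>carrier := harmonic V\<rparr>)"

definition harmonic_map :: "'a dg_space \<Rightarrow> 'a dg_space \<Rightarrow> ('a \<Rightarrow> 'a) \<Rightarrow> 'a \<Rightarrow> 'a" where
  "harmonic_map V W f = (\<lambda>x\<in>harmonic V. orthogonal_projection W (harmonic W) (f x))"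

definition harmonic_functor :: "('a dg_space, 'a \<Rightarrow> 'a, 'a inner_space, 'a \<Rightarrow> 'a) functor_data" where
  "harmonic_functor = \<lparr>omap = harmonic_space, fmap = harmonic_map\<rparr>"


section \<open>The homology functor\<close>

definition cycles :: "'a dg_space \<Rightarrow> 'a set" where
  "cycles V = {x \<in> carrier V. diff V x = \<zero>\<^bsub>V\<^esub>}"

definition boundaries :: "'a dg_space \<Rightarrow> 'a set" where
  "boundaries V = diff V ` carrier V"

definition homology_class :: "'a dg_space \<Rightarrow> 'a \<Rightarrow> 'a set" where
  "homology_class V z = boundaries V +>\<^bsub>V\<^esub> z"

definition harmonic_representative :: "'a dg_space \<Rightarrow> 'a set \<Rightarrow> 'a" where
  "harmonic_representative V X = (THE z. z \<in> harmonic V \<and> homology_class V z = X)"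

text \<open>The argument of \<^const>\<open>the_elem\<close> below is the set of the classes $[r z]$ (respectively
  $[f(z)]$) for all representatives $z$ of $X$; it is a singleton.
  The inner product is the one transported from the harmonic space along $z \mapsto [z]$.\<close>

definition homology_space :: "'a dg_space \<Rightarrow> 'a set inner_space" where
  "homology_space V = \<lparr>carrier = homology_class V ` cycles V, mult = undefined, one = undefined,
     zero = boundaries V, add = set_add V,
     smult = (\<lambda>r X. the_elem ((\<lambda>z. homology_class V (r \<odot>\<^bsub>V\<^esub> z)) ` X)),
     iprod = (\<lambda>X Y. iprod V (harmonic_representative V X) (harmonic_representative V Y))\<rparr>"

definition homology_map :: "'a dg_space \<Rightarrow> 'a dg_space \<Rightarrow> ('a \<Rightarrow> 'a) \<Rightarrow> 'a set \<Rightarrow> 'a set" where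
  "homology_map V W f =
     (\<lambda>X\<in>carrier (homology_space V). the_elem ((\<lambda>z. homology_class W (f z)) ` X))"

definition homology_functor ::
    "('a dg_space, 'a \<Rightarrow> 'a, 'a set inner_space, 'a set \<Rightarrow> 'a set) functor_data" where
  "homology_functor = \<lparr>omap = homology_space, fmap = homology_map\<rparr>"

end

theory Submission
  imports Defs
begin

text \<open>
  The natural isomorphism is $z \mapsto [z]$, from harmonic elements to homology classes, and it exists
  already for the functors on DGI; a persistent space $\mathcal{S}$ enters only by composing with it.

  \<^item> It is a bijection by Hodge theory (\<open>hodge\<close>). By definition of $d^*$, a cycle is harmonic if and
    only if it is orthogonal to the boundaries (\<open>harmonic_iff\<close>). Subtracting from a cycle its
    orthogonal projection to the boundaries therefore gives a harmonic element of the same class, and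
    there is only one, since the difference of two is a boundary orthogonal to all boundaries.
    The existence of $d^*$ and of the projection both come from the Riesz representation theorem on a
    finite-dimensional subspace (\<open>riesz_on_span\<close>).

  \<^item> It is natural because harmonic projection does not change the class of a cycle: for harmonic $x$
    the element $f(x)$ is a cycle, and its projection $h(f)(x)$ represents
    $[f(x)] = H(f)[x]$ (\<open>homology_class_harmonic_map\<close>).

  Functoriality of $H$ is read off from representatives. Functoriality of $h$ and the linearity of
  $h(f)$ are then transported back along the injection $z \mapsto [z]$, under which $h(f)$ becomes
  $H(f)$.
\<close>

section \<open>Linear functionals on inner product spaces\<close>

context inner_product_space
begin

lemma iprod_add_right:
  "\<lbrakk>x \<in> carrier V; y \<in> carrier V; z \<in> carrier V\<rbrakk>
    \<Longrightarrow> iprod V x (y \<oplus> z) = iprod V x y + iprod V x z"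
  using iprod_add[of y z x] iprod_sym[of x] by simp

lemma iprod_smult_right:
  "\<lbrakk>x \<in> carrier V; y \<in> carrier V\<rbrakk> \<Longrightarrow> iprod V x (r \<odot>\<^bsub>V\<^esub> y) = r * iprod V x y"
  using iprod_smult[of y x r] iprod_sym[of x] by simp

lemma iprod_zero_left [simp]: "x \<in> carrier V \<Longrightarrow> iprod V \<zero> x = 0"
  using iprod_add[of \<zero> \<zero> x] by simp

lemma iprod_zero_right [simp]: "x \<in> carrier V \<Longrightarrow> iprod V x \<zero> = 0"
  using iprod_sym[of x \<zero>] by simp

lemma iprod_self_eq_zero_iff: "x \<in> carrier V \<Longrightarrow> iprod V x x = 0 \<longleftrightarrow> x = \<zero>"
  using iprod_pos[of x] by (cases "x = \<zero>") auto

definition linear_functional :: "('a \<Rightarrow> real) \<Rightarrow> bool" where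
  "linear_functional \<phi> \<longleftrightarrow>
     (\<forall>x \<in> carrier V. \<forall>y \<in> carrier V. \<phi> (x \<oplus> y) = \<phi> x + \<phi> y) \<and>
     (\<forall>r. \<forall>x \<in> carrier V. \<phi> (r \<odot>\<^bsub>V\<^esub> x) = r * \<phi> x)"

lemma linear_functional_iprod: "y \<in> carrier V \<Longrightarrow> linear_functional (\<lambda>x. iprod V x y)"
  by (simp add: linear_functional_def iprod_add iprod_smult)

lemma linear_functional_zero: "linear_functional \<phi> \<Longrightarrow> \<phi> \<zero> = 0"
  unfolding linear_functional_def by (metis M.zero_closed add_cancel_right_left M.r_zero)

lemma linear_functional_diff:
  assumes "linear_functional \<phi>" "x \<in> carrier V" "y \<in> carrier V"
  shows "\<phi> (x \<ominus> y) = \<phi> x - \<phi> y"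
proof -
  have "\<phi> (x \<ominus> y) + \<phi> y = \<phi> ((x \<ominus> y) \<oplus> y)"
    using assms by (simp add: linear_functional_def)
  also have "(x \<ominus> y) \<oplus> y = x"
    using assms by (simp add: M.minus_eq M.a_assoc M.l_neg)
  finally show ?thesis by simp
qed

lemma iprod_diff:
  "\<lbrakk>x \<in> carrier V; y \<in> carrier V; z \<in> carrier V\<rbrakk>
    \<Longrightarrow> iprod V (x \<ominus> y) z = iprod V x z - iprod V y z"
  by (rule linear_functional_diff[OF linear_functional_iprod])

lemma linear_functional_eq_on_span:
  assumes \<phi>: "linear_functional \<phi>" and \<psi>: "linear_functional \<psi>"
    and S: "S \<subseteq> carrier V" and eq: "\<And>s. s \<in> S \<Longrightarrow> \<phi> s = \<psi> s" and x: "x \<in> span S"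
  shows "\<phi> x = \<psi> x"
proof -
  have "submodule real_field {y \<in> carrier V. \<phi> y = \<psi> y} V"
    using \<phi> \<psi> linear_functional_zero[OF \<phi>] linear_functional_zero[OF \<psi>]
    by unfold_locales (auto simp: linear_functional_def)
  then have "span S \<subseteq> {y \<in> carrier V. \<phi> y = \<psi> y}"
    using S eq by (intro span_is_subset) auto
  then show ?thesis using x by auto
qed

text \<open>The Riesz representation theorem on the span of a finite set, by the induction step of the
  Gram--Schmidt process: with the part of the new vector $v$ orthogonal to the old span known, the
  representing vector is corrected along it. The orthogonal projection $p$ of $v$ is itself the
  vector that represents $\langle\cdot,v\rangle$ on the old span, which is why the induction is over
  all functionals at once.\<close>

lemma riesz_on_span:
  assumes "finite S" "S \<subseteq> carrier V" "linear_functional \<phi>"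
  shows "\<exists>z \<in> span S. \<forall>x \<in> span S. \<phi> x = iprod V x z"
  using assms
proof (induction S arbitrary: \<phi> rule: finite_induct)
  case empty
  have "\<zero> \<in> span {}" using span_is_submodule[of "{}"] submodule.zero_closed by blast
  moreover have "\<phi> x = iprod V x \<zero>" if "x \<in> span {}" for x
    using linear_functional_eq_on_span[OF empty.prems(2) linear_functional_iprod, of \<zero> "{}" x] that
    by simp
  ultimately show ?case by blast
next
  case (insert v S)
  have v: "v \<in> carrier V" and S: "S \<subseteq> carrier V" using insert.prems by auto
  have sub: "span S \<subseteq> carrier V" using S by (rule span_is_subset2)
  obtain z where z: "z \<in> span S" "\<And>x. x \<in> span S \<Longrightarrow> \<phi> x = iprod V x z"
    using insert.IH[OF S insert.prems(2)] by blast
  obtain p where p: "p \<in> span S" "\<And>x. x \<in> span S \<Longrightarrow> iprod V x v = iprod V x p"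
    using insert.IH[OF S linear_functional_iprod[OF v]] by blast
  define w where "w = v \<ominus> p"
  have zc: "z \<in> carrier V" and pc: "p \<in> carrier V" using z(1) p(1) sub by auto
  have w: "w \<in> carrier V" using v pc by (simp add: w_def)
  have orth: "iprod V w x = 0" if "x \<in> span S" for x
    using that sub v pc p(2)[OF that] iprod_sym[of x v] iprod_sym[of x p]
    by (auto simp: w_def iprod_diff)
  have v_eq: "v = w \<oplus> p"
    using v pc by (simp add: w_def M.minus_eq M.a_assoc M.l_neg)
  \<comment> \<open>If $w = 0$, the coefficient is the junk value $0$ and the old vector remains correct.\<close>
  define c where "c = \<phi> w / iprod V w w"
  define z' where "z' = z \<oplus> c \<odot>\<^bsub>V\<^esub> w"
  have z'c: "z' \<in> carrier V" using zc w by (simp add: z'_def)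
  have on_S: "\<phi> x = iprod V x z'" if "x \<in> span S" for x
  proof -
    have x: "x \<in> carrier V" using that sub by auto
    then have "iprod V x z' = iprod V x z + c * iprod V x w"
      using zc w by (simp add: z'_def iprod_add_right iprod_smult_right)
    then show ?thesis using z(2)[OF that] orth[OF that] iprod_sym[OF x w] by simp
  qed
  have "iprod V w z' = c * iprod V w w"
    using zc w orth[OF z(1)] by (simp add: z'_def iprod_add_right iprod_smult_right)
  also have "\<dots> = \<phi> w"
    using iprod_self_eq_zero_iff[OF w] linear_functional_zero[OF insert.prems(2)]
    by (auto simp: c_def)
  finally have "\<phi> v = iprod V v z'"
    using insert.prems(2) on_S[OF p(1)] w pc z'c
    by (simp add: v_eq iprod_add linear_functional_def)
  then have "\<phi> x = iprod V x z'" if "x \<in> insert v S" for x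
    using that on_S in_own_span[OF S] by auto
  then have rep: "\<phi> x = iprod V x z'" if "x \<in> span (insert v S)" for x
    using linear_functional_eq_on_span[OF insert.prems(2) linear_functional_iprod[OF z'c]
        insert.prems(1) _ that] by blast
  interpret I: submodule real_field "span (insert v S)" V
    using insert.prems(1) by (rule span_is_submodule)
  have "z \<in> span (insert v S)" "p \<in> span (insert v S)" "v \<in> span (insert v S)"
    using span_is_monotone[of S "insert v S"] z(1) p(1) in_own_span[OF insert.prems(1)] by auto
  moreover have "w = v \<oplus> (- 1) \<odot>\<^bsub>V\<^esub> p"
    using smult_minus_1[OF pc] by (simp add: w_def M.minus_eq class_ring_simps)
  ultimately have "z' \<in> span (insert v S)"
    by (simp add: z'_def)
  then show ?case using rep by blast
qed

corollary riesz_representation: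
  assumes fin_dim "linear_functional \<phi>"
  shows "\<exists>z \<in> carrier V. \<forall>x \<in> carrier V. \<phi> x = iprod V x z"
proof -
  obtain A where "finite A" "A \<subseteq> carrier V" "span A = carrier V"
    using assms(1) by (auto simp: fin_dim_def)
  then show ?thesis using riesz_on_span[OF _ _ assms(2), of A] by simp
qed

text \<open>The orthogonal projection of $x$ to a subspace is the vector of that subspace that represents
  $\langle\cdot,x\rangle$ on it.\<close>

lemma projection_on_span:
  assumes "finite S" "S \<subseteq> carrier V" "x \<in> carrier V"
  shows "\<exists>p \<in> span S. \<forall>y \<in> span S. iprod V y (x \<ominus> p) = 0"
proof -
  obtain p where p: "p \<in> span S" "\<And>y. y \<in> span S \<Longrightarrow> iprod V y x = iprod V y p"
    using riesz_on_span[OF assms(1,2) linear_functional_iprod[OF assms(3)]] by blast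
  have "iprod V y (x \<ominus> p) = 0" if "y \<in> span S" for y
    using p(2)[OF that] p(1) that assms(3) span_is_subset2[OF assms(2)]
      iprod_sym[of y x] iprod_sym[of y p] iprod_sym[of y "x \<ominus> p"]
    by (auto simp: iprod_diff subset_iff)
  then show ?thesis using p(1) by blast
qed

text \<open>Equations and the existence of negatives pass to operations induced along a surjection from a
  subspace, and positivity passes because the surjection preserves the inner product. The harmonic space (inclusion) and
  the homology space ($z \mapsto [z]$ on harmonic $z$) are instances.\<close>

lemma inner_product_space_image:
  fixes Y :: "('b, 'y) inner_space_scheme"
  assumes A: "submodule real_field A V"
    and carrier: "carrier Y = \<phi> ` A"
    and zero: "\<zero>\<^bsub>Y\<^esub> = \<phi> \<zero>"
    and add: "\<And>x y. \<lbrakk>x \<in> A; y \<in> A\<rbrakk> \<Longrightarrow> \<phi> x \<oplus>\<^bsub>Y\<^esub> \<phi> y = \<phi> (x \<oplus> y)"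
    and smult: "\<And>r x. x \<in> A \<Longrightarrow> r \<odot>\<^bsub>Y\<^esub> \<phi> x = \<phi> (r \<odot>\<^bsub>V\<^esub> x)"
    and iprod: "\<And>x y. \<lbrakk>x \<in> A; y \<in> A\<rbrakk> \<Longrightarrow> iprod Y (\<phi> x) (\<phi> y) = iprod V x y"
  shows "inner_product_space Y"
proof -
  interpret A: submodule real_field A V by (rule A)
  have c: "x \<in> carrier V" if "x \<in> A" for x using that A.subset by blast
  have sm: "r \<odot>\<^bsub>V\<^esub> x \<in> A" if "x \<in> A" for r x using that by (intro A.smult_closed) auto
  have "vectorspace real_field Y"
  proof (rule vs_criteria)
    show "\<forall>v \<in> carrier Y. \<exists>w \<in> carrier Y. v \<oplus>\<^bsub>Y\<^esub> w = \<zero>\<^bsub>Y\<^esub>"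
    proof
      fix v assume "v \<in> carrier Y"
      then obtain x where x: "x \<in> A" "v = \<phi> x" by (auto simp: carrier)
      have "x \<oplus> (- 1) \<odot>\<^bsub>V\<^esub> x = \<zero>"
        using smult_minus_1[of x] c[OF x(1)] by (simp add: class_ring_simps M.r_neg)
      then have "v \<oplus>\<^bsub>Y\<^esub> \<phi> ((- 1) \<odot>\<^bsub>V\<^esub> x) = \<zero>\<^bsub>Y\<^esub>"
        using x by (simp add: add sm zero)
      then show "\<exists>w \<in> carrier Y. v \<oplus>\<^bsub>Y\<^esub> w = \<zero>\<^bsub>Y\<^esub>"
        using sm[OF x(1)] by (auto simp: carrier)
    qed
  qed (use class_field in \<open>auto simp: carrier zero add smult sm c M.a_ac smult_assoc1[simplified]
      smult_l_distr[simplified] smult_r_distr smult_one[simplified]\<close>)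
  moreover have "inner_product_space_axioms Y"
  proof
    fix x assume "x \<in> carrier Y" "x \<noteq> \<zero>\<^bsub>Y\<^esub>"
    then obtain a where "a \<in> A" "x = \<phi> a" "a \<noteq> \<zero>" by (auto simp: carrier zero)
    then show "iprod Y x x > 0" using c by (simp add: iprod iprod_pos)
  qed (auto simp: carrier add smult iprod sm c iprod_sym iprod_add iprod_add_right iprod_smult
      iprod_smult_right)
  ultimately show ?thesis by (rule inner_product_space.intro)
qed

end

section \<open>Hodge theory of a single space\<close>

text \<open>\<^const>\<open>harmonic\<close>, \<^const>\<open>homology_space\<close> and their relatives are defined for records without
  extension fields, whereas \<^locale>\<open>dgi_space\<close> covers arbitrary extensions.\<close>

locale dgi_object = dgi_space V for V :: "'a dg_space" (structure)
begin

interpretation d: linear_map real_field V V "diff V"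
  by (rule diff_linear)

text \<open>The orthogonal projection to the boundaries is available once they are known to be the span of a
  finite set.\<close>

lemma boundaries_eq_span_image:
  assumes "S \<subseteq> carrier V" "span S = carrier V"
  shows "boundaries V = span (diff V ` S)"
proof
  have dS: "diff V ` S \<subseteq> carrier V" using assms(1) by auto
  interpret I: submodule real_field "span (diff V ` S)" V
    using dS by (rule span_is_submodule)
  have "submodule real_field {x \<in> carrier V. diff V x \<in> span (diff V ` S)} V"
    by unfold_locales auto
  then have "span S \<subseteq> {x \<in> carrier V. diff V x \<in> span (diff V ` S)}"
    using assms(1) in_own_span[OF dS] by (intro span_is_subset) auto
  then show "boundaries V \<subseteq> span (diff V ` S)"
    using assms(2) by (auto simp: boundaries_def)
  show "span (diff V ` S) \<subseteq> boundaries V"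
    using assms(1) d.im_is_submodule by (intro span_is_subset) (auto simp: boundaries_def d.im_def)
qed

lemma boundaries_submodule: "submodule real_field (boundaries V) V"
  using d.im_is_submodule by (simp add: boundaries_def d.im_def)

lemma cycles_submodule: "submodule real_field (cycles V) V"
  using d.ker_is_submodule by (simp add: cycles_def d.ker_def)

lemma boundaries_subset_cycles: "boundaries V \<subseteq> cycles V"
  by (auto simp: boundaries_def cycles_def diff_diff)

lemma cycles_subset: "cycles V \<subseteq> carrier V"
  by (auto simp: cycles_def)

lemma adjoint_eqI:
  assumes "z \<in> carrier V" "\<And>x. x \<in> carrier V \<Longrightarrow> iprod V (T x) y = iprod V x z"
  shows "adjoint_map V T y = z"
  unfolding adjoint_map_def
proof (rule the_equality)
  fix z' assume z': "z' \<in> carrier V \<and> (\<forall>x \<in> carrier V. iprod V (T x) y = iprod V x z')"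
  then have "iprod V x z' = iprod V x z" if "x \<in> carrier V" for x using assms(2) that by simp
  then have "iprod V (z' \<ominus> z) (z' \<ominus> z) = 0"
    using z' assms(1) iprod_sym[of z' "z' \<ominus> z"] iprod_sym[of z "z' \<ominus> z"] by (simp add: iprod_diff)
  then show "z' = z" using z' assms(1) iprod_self_eq_zero_iff[of "z' \<ominus> z"] by simp
qed (use assms in blast)

text \<open>$d^* y$ is the vector that represents the functional $x \mapsto \langle dx, y\rangle$; it
  exists because $V$ is finite-dimensional.\<close>

lemma adjoint_diff:
  assumes "y \<in> carrier V"
  shows "adjoint_map V (diff V) y \<in> carrier V"
    and "x \<in> carrier V \<Longrightarrow> iprod V (diff V x) y = iprod V x (adjoint_map V (diff V) y)"
proof -
  have "linear_functional (\<lambda>x. iprod V (diff V x) y)"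
    using assms by (simp add: linear_functional_def iprod_add iprod_smult)
  then obtain z where "z \<in> carrier V" "\<forall>x \<in> carrier V. iprod V (diff V x) y = iprod V x z"
    using riesz_representation[OF fin_dim] by blast
  then show "adjoint_map V (diff V) y \<in> carrier V"
    "x \<in> carrier V \<Longrightarrow> iprod V (diff V x) y = iprod V x (adjoint_map V (diff V) y)"
    using adjoint_eqI[of z "diff V" y] by auto
qed

text \<open>$\ker d^* = (\operatorname{im} d)^\perp$ by the adjunction
  $\langle dx, y\rangle = \langle x, d^* y\rangle$.\<close>

lemma harmonic_iff:
  "x \<in> harmonic V \<longleftrightarrow> x \<in> cycles V \<and> (\<forall>b \<in> boundaries V. iprod V b x = 0)"
proof -
  have "adjoint_map V (diff V) x = \<zero> \<longleftrightarrow> (\<forall>b \<in> boundaries V. iprod V b x = 0)"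
    if x: "x \<in> carrier V"
  proof
    assume "adjoint_map V (diff V) x = \<zero>"
    then show "\<forall>b \<in> boundaries V. iprod V b x = 0"
      using adjoint_diff(2)[OF x] by (auto simp: boundaries_def)
  next
    assume "\<forall>b \<in> boundaries V. iprod V b x = 0"
    then show "adjoint_map V (diff V) x = \<zero>"
      by (intro adjoint_eqI) (auto simp: boundaries_def)
  qed
  then show ?thesis by (auto simp: harmonic_def cycles_def)
qed

lemma harmonic_subset_cycles: "harmonic V \<subseteq> cycles V"
  by (auto simp: harmonic_iff)

lemma harmonic_subset: "harmonic V \<subseteq> carrier V"
  using harmonic_subset_cycles cycles_subset by blast

lemma harmonic_submodule: "submodule real_field (harmonic V) V"
proof -
  interpret Z: submodule real_field "cycles V" V by (rule cycles_submodule)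
  have bc: "b \<in> boundaries V \<Longrightarrow> b \<in> carrier V" for b
    using boundaries_subset_cycles cycles_subset by blast
  have hc: "x \<in> harmonic V \<Longrightarrow> x \<in> carrier V" for x
    using harmonic_subset by blast
  have 0: "\<zero> \<in> harmonic V"
    by (simp add: harmonic_iff bc)
  have add: "x \<oplus> y \<in> harmonic V" if "x \<in> harmonic V" "y \<in> harmonic V" for x y
    using that hc[OF that(1)] hc[OF that(2)] by (simp add: harmonic_iff iprod_add_right bc)
  have smult: "r \<odot>\<^bsub>V\<^esub> x \<in> harmonic V" if "x \<in> harmonic V" for x r
    using that hc[OF that] by (simp add: harmonic_iff iprod_smult_right bc)
  show ?thesis
    using harmonic_subset 0 add smult by unfold_locales
qed

sublocale B: abelian_subgroup "boundaries V" V
proof -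
  interpret B: submodule real_field "boundaries V" V by (rule boundaries_submodule)
  have "\<ominus> x \<in> boundaries V" if x: "x \<in> boundaries V" for x
  proof -
    have "(- 1) \<odot>\<^bsub>V\<^esub> x \<in> boundaries V"
      using x by (intro B.smult_closed) auto
    moreover have "(- 1) \<odot>\<^bsub>V\<^esub> x = \<ominus> x"
      using smult_minus_1[of x] x B.subset by (auto simp: class_ring_simps)
    ultimately show ?thesis by simp
  qed
  moreover have ne: "boundaries V \<noteq> {}"
    using B.zero_closed by blast
  ultimately have "additive_subgroup (boundaries V) V"
    using B.subset ne by (intro additive_subgroup.intro M.add.subgroupI) (auto simp: a_inv_def)
  then show "abelian_subgroup (boundaries V) V"
    by (rule abelian_subgroupI3[OF _ M.abelian_group_axioms])
qed

lemma homology_class_self: "x \<in> carrier V \<Longrightarrow> x \<in> homology_class V x"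
  unfolding homology_class_def by (rule B.a_rcos_self)

lemma homology_class_eq_iff:
  assumes "x \<in> carrier V" "y \<in> carrier V"
  shows "homology_class V x = homology_class V y \<longleftrightarrow> x \<ominus> y \<in> boundaries V"
  using assms B.a_rcos_module[of y x] B.a_repr_independence'[of x y] B.a_rcos_self[of x]
  by (auto simp: homology_class_def M.minus_eq)

lemma in_homology_class_iff:
  assumes "x \<in> carrier V"
  shows "y \<in> homology_class V x \<longleftrightarrow> y \<in> carrier V \<and> homology_class V y = homology_class V x"
proof -
  have "y \<in> carrier V" if "y \<in> homology_class V x"
    using that assms B.a_subset by (auto simp: homology_class_def a_r_coset_def')
  then show ?thesis
    using assms B.a_repr_independence'[of y x] B.a_rcos_self[of y]
    by (auto simp: homology_class_def)
qed

text \<open>Scalar multiplication and induced maps on homology are given by applying \<^const>\<open>the_elem\<close> to the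
  values on all representatives; this computes them from one representative.\<close>

lemma the_elem_homology_class:
  assumes "x \<in> carrier V"
    and "\<And>y. \<lbrakk>y \<in> carrier V; x \<ominus> y \<in> boundaries V\<rbrakk> \<Longrightarrow> g x = g y"
  shows "the_elem (g ` homology_class V x) = g x"
proof -
  have "g ` homology_class V x = {g x}"
  proof (intro equalityI subsetI)
    fix u assume "u \<in> g ` homology_class V x"
    then obtain y where y: "y \<in> carrier V" "homology_class V x = homology_class V y" "u = g y"
      using in_homology_class_iff[OF assms(1)] by auto
    then show "u \<in> {g x}"
      using assms(2)[OF y(1)] homology_class_eq_iff[OF assms(1) y(1)] by simp
  qed (use homology_class_self[OF assms(1)] in blast)
  then show ?thesis by simp
qed

text \<open>The harmonic representative of a cycle $z$ is $z - p$ with $p$ the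
  orthogonal projection of $z$ to the boundaries; two of them differ by a boundary that is
  orthogonal to itself.\<close>

theorem hodge:
  assumes "z \<in> cycles V"
  shows "\<exists>!h. h \<in> harmonic V \<and> homology_class V h = homology_class V z"
proof (rule ex_ex1I)
  have z: "z \<in> carrier V" using assms cycles_subset by blast
  obtain S where S: "finite S" "S \<subseteq> carrier V" "span S = carrier V"
    using fin_dim by (auto simp: fin_dim_def)
  obtain p where p: "p \<in> boundaries V" "\<forall>b \<in> boundaries V. iprod V b (z \<ominus> p) = 0"
    using projection_on_span[of "diff V ` S" z] S z
    by (auto simp: boundaries_eq_span_image[OF S(2,3)])
  have pc: "p \<in> carrier V" "diff V p = \<zero>"
    using p(1) boundaries_subset_cycles by (auto simp: cycles_def)
  have "z \<ominus> p \<in> harmonic V"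
    using p(2) pc assms by (simp add: harmonic_iff cycles_def)
  moreover have "(z \<ominus> p) \<ominus> z = \<ominus> p"
    using z pc by (simp add: M.minus_eq M.a_comm[of z] M.a_assoc M.r_neg)
  then have "homology_class V (z \<ominus> p) = homology_class V z"
    using z pc p(1) by (simp add: homology_class_eq_iff)
  ultimately show "\<exists>h. h \<in> harmonic V \<and> homology_class V h = homology_class V z" by blast
next
  fix h k
  assume h: "h \<in> harmonic V \<and> homology_class V h = homology_class V z"
    and k: "k \<in> harmonic V \<and> homology_class V k = homology_class V z"
  then have c: "h \<in> carrier V" "k \<in> carrier V" using harmonic_subset by auto
  then have b: "h \<ominus> k \<in> boundaries V" using h k homology_class_eq_iff by metis
  have "iprod V (h \<ominus> k) (h \<ominus> k) = 0"
    using b c h k iprod_sym[of h "h \<ominus> k"] iprod_sym[of k "h \<ominus> k"]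
    by (simp add: iprod_diff harmonic_iff)
  then show "h = k" using c iprod_self_eq_zero_iff[of "h \<ominus> k"] by simp
qed

lemma harmonic_representative:
  assumes "z \<in> cycles V"
  shows "harmonic_representative V (homology_class V z) \<in> harmonic V"
    and "homology_class V (harmonic_representative V (homology_class V z)) = homology_class V z"
  unfolding harmonic_representative_def using theI'[OF hodge[OF assms]] by auto

lemma harmonic_representative_eqI:
  "h \<in> harmonic V \<Longrightarrow> harmonic_representative V (homology_class V h) = h"
  unfolding harmonic_representative_def using hodge[of h] harmonic_subset_cycles
  by (intro the1_equality) auto

text \<open>On cycles the $d^*V$ component of the Hodge decomposition vanishes, so the harmonic
  projection only removes a boundary.\<close>

lemma orthogonal_projection_harmonic:
  assumes "z \<in> cycles V"
  shows "orthogonal_projection V (harmonic V) z = harmonic_representative V (homology_class V z)"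
  unfolding orthogonal_projection_def
proof (rule the_equality)
  let ?h = "harmonic_representative V (homology_class V z)"
  note h = harmonic_representative[OF assms]
  have c: "z \<in> carrier V" "?h \<in> carrier V" using assms h harmonic_subset cycles_subset by auto
  then have b: "z \<ominus> ?h \<in> boundaries V" using h(2) homology_class_eq_iff by metis
  then show *: "?h \<in> harmonic V \<and> (\<forall>w \<in> harmonic V. iprod V (z \<ominus> ?h) w = 0)"
    using h(1) by (auto simp: harmonic_iff)
  fix u assume u: "u \<in> harmonic V \<and> (\<forall>w \<in> harmonic V. iprod V (z \<ominus> u) w = 0)"
  then have uc: "u \<in> carrier V" using harmonic_subset by auto
  have "iprod V ?h w = iprod V u w" if "w \<in> harmonic V" for w
  proof -
    have "w \<in> carrier V" using that harmonic_subset by blast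
    moreover have "iprod V (z \<ominus> ?h) w = 0" "iprod V (z \<ominus> u) w = 0" using * u that by blast+
    ultimately show ?thesis using c uc by (simp add: iprod_diff)
  qed
  then have "iprod V (u \<ominus> ?h) u = 0" "iprod V (u \<ominus> ?h) ?h = 0"
    using u h(1) c uc by (simp_all add: iprod_diff)
  then have "iprod V (u \<ominus> ?h) (u \<ominus> ?h) = 0"
    using c uc iprod_sym[of u "u \<ominus> ?h"] iprod_sym[of ?h "u \<ominus> ?h"] by (simp add: iprod_diff)
  then show "u = ?h" using c uc iprod_self_eq_zero_iff[of "u \<ominus> ?h"] by simp
qed


lemma boundaries_smult_closed:
  assumes "b \<in> boundaries V"
  shows "r \<odot>\<^bsub>V\<^esub> b \<in> boundaries V"
  using submodule.smult_closed[OF boundaries_submodule _ assms] by simp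

lemma homology_add:
  "\<lbrakk>x \<in> carrier V; y \<in> carrier V\<rbrakk>
    \<Longrightarrow> homology_class V x \<oplus>\<^bsub>homology_space V\<^esub> homology_class V y = homology_class V (x \<oplus> y)"
  by (simp add: homology_space_def homology_class_def B.a_rcos_sum)

lemma homology_smult:
  assumes "x \<in> carrier V"
  shows "r \<odot>\<^bsub>homology_space V\<^esub> homology_class V x = homology_class V (r \<odot>\<^bsub>V\<^esub> x)"
proof -
  have "homology_class V (r \<odot>\<^bsub>V\<^esub> x) = homology_class V (r \<odot>\<^bsub>V\<^esub> y)"
    if "y \<in> carrier V" "x \<ominus> y \<in> boundaries V" for y
  proof -
    have "r \<odot>\<^bsub>V\<^esub> x \<ominus> r \<odot>\<^bsub>V\<^esub> y = r \<odot>\<^bsub>V\<^esub> (x \<ominus> y)"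
      using assms that(1) by (simp add: M.minus_eq smult_r_distr smult_r_minus)
    then show ?thesis
      using assms that boundaries_smult_closed[OF that(2)] by (simp add: homology_class_eq_iff)
  qed
  then show ?thesis
    using the_elem_homology_class[OF assms, of "\<lambda>z. homology_class V (r \<odot>\<^bsub>V\<^esub> z)"]
    by (simp add: homology_space_def)
qed

lemma homology_carrier: "carrier (homology_space V) = homology_class V ` cycles V"
  by (simp add: homology_space_def)

lemma homology_carrier_harmonic: "carrier (homology_space V) = homology_class V ` harmonic V"
proof
  show "carrier (homology_space V) \<subseteq> homology_class V ` harmonic V"
  proof
    fix X assume "X \<in> carrier (homology_space V)"
    then obtain z where "z \<in> cycles V" "X = homology_class V z" by (auto simp: homology_carrier)
    then show "X \<in> homology_class V ` harmonic V" using harmonic_representative[of z]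
      by (metis image_eqI)
  qed
qed (use harmonic_subset_cycles in \<open>auto simp: homology_carrier\<close>)

lemma harmonic_space_simps [simp]:
  "carrier (harmonic_space V) = harmonic V"
  "\<zero>\<^bsub>harmonic_space V\<^esub> = \<zero>"
  "x \<oplus>\<^bsub>harmonic_space V\<^esub> y = x \<oplus> y"
  "r \<odot>\<^bsub>harmonic_space V\<^esub> x = r \<odot>\<^bsub>V\<^esub> x"
  "iprod (harmonic_space V) x y = iprod V x y"
  by (simp_all add: harmonic_space_def inner_space.truncate_def)

lemma inner_product_space_harmonic: "inner_product_space (harmonic_space V)"
  by (rule inner_product_space_image[OF harmonic_submodule, of _ "\<lambda>x. x"]) simp_all

lemma inner_product_space_homology: "inner_product_space (homology_space V)"
proof (rule inner_product_space_image[OF harmonic_submodule, of _ "homology_class V"])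
  show "\<zero>\<^bsub>homology_space V\<^esub> = homology_class V \<zero>"
    using B.a_rcos_const[of \<zero>] by (simp add: homology_space_def homology_class_def)
qed (use harmonic_subset in \<open>auto simp: homology_carrier_harmonic homology_add homology_smult subset_iff\<close>,
  simp add: homology_space_def harmonic_representative_eqI)

lemma bij_betw_homology_class:
  "bij_betw (homology_class V) (carrier (harmonic_space V)) (carrier (homology_space V))"
  unfolding bij_betw_def homology_carrier_harmonic
  by (simp add: inj_on_inverseI[where g = "harmonic_representative V"] harmonic_representative_eqI)

end

section \<open>Isomorphisms of inner product spaces\<close>

lemma Inn_homI:
  assumes "inner_product_space X" "inner_product_space Y" "f \<in> extensional (carrier X)"
    and "\<And>x. x \<in> carrier X \<Longrightarrow> f x \<in> carrier Y"
    and "\<And>x y. \<lbrakk>x \<in> carrier X; y \<in> carrier X\<rbrakk> \<Longrightarrow> f (x \<oplus>\<^bsub>X\<^esub> y) = f x \<oplus>\<^bsub>Y\<^esub> f y"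
    and "\<And>r x. x \<in> carrier X \<Longrightarrow> f (r \<odot>\<^bsub>X\<^esub> x) = r \<odot>\<^bsub>Y\<^esub> f x"
  shows "f \<in> Inn_hom X Y"
proof -
  interpret X: inner_product_space X by fact
  interpret Y: inner_product_space Y by fact
  have "f \<in> LinearCombinations.module_hom real_field X Y"
    using assms by (auto simp: LinearCombinations.module_hom_def)
  then have "linear_map real_field X Y f"
    by (intro linear_map.intro mod_hom.intro mod_hom_axioms.intro) unfold_locales
  then show ?thesis using assms(3) by (simp add: Inn_hom_def)
qed

lemma Inn_homD:
  assumes "f \<in> Inn_hom X Y" "x \<in> carrier X"
  shows "f x \<in> carrier Y"
    and "y \<in> carrier X \<Longrightarrow> f (x \<oplus>\<^bsub>X\<^esub> y) = f x \<oplus>\<^bsub>Y\<^esub> f y"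
    and "f (r \<odot>\<^bsub>X\<^esub> x) = r \<odot>\<^bsub>Y\<^esub> f x"
proof -
  interpret linear_map real_field X Y f using assms(1) by (simp add: Inn_hom_def)
  show "f x \<in> carrier Y" "y \<in> carrier X \<Longrightarrow> f (x \<oplus>\<^bsub>X\<^esub> y) = f x \<oplus>\<^bsub>Y\<^esub> f y"
    "f (r \<odot>\<^bsub>X\<^esub> x) = r \<odot>\<^bsub>Y\<^esub> f x"
    using assms(2) by simp_all
qed

lemma Inn_iso_if_bij_betw:
  assumes X: "inner_product_space X" and Y: "inner_product_space Y"
    and f: "f \<in> Inn_hom X Y" and bij: "bij_betw f (carrier X) (carrier Y)"
  shows "Inn_iso X Y f"
proof -
  interpret X: inner_product_space X by fact
  define g where "g = (\<lambda>y\<in>carrier Y. inv_into (carrier X) f y)"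
  have g: "g y \<in> carrier X" "f (g y) = y" if "y \<in> carrier Y" for y
    using that bij by (auto simp: g_def bij_betw_def f_inv_into_f inv_into_into)
  have gf: "g (f x) = x" if "x \<in> carrier X" for x
    using that bij Inn_homD(1)[OF f that] by (simp add: g_def bij_betw_def)
  have "g \<in> Inn_hom Y X"
  proof (rule Inn_homI[OF Y X])
    show "g (x \<oplus>\<^bsub>Y\<^esub> y) = g x \<oplus>\<^bsub>X\<^esub> g y" if "x \<in> carrier Y" "y \<in> carrier Y" for x y
      using gf[of "g x \<oplus>\<^bsub>X\<^esub> g y"] g[OF that(1)] g[OF that(2)] Inn_homD(2)[OF f] by simp
    show "g (r \<odot>\<^bsub>Y\<^esub> x) = r \<odot>\<^bsub>X\<^esub> g x" if "x \<in> carrier Y" for r x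
      using gf[of "r \<odot>\<^bsub>X\<^esub> g x"] g[OF that] Inn_homD(3)[OF f] by simp
  qed (use g in \<open>auto simp: g_def\<close>)
  moreover have "compose (carrier X) g f = (\<lambda>x\<in>carrier X. x)"
    using gf by (auto simp: compose_def restrict_def)
  moreover have "compose (carrier Y) f g = (\<lambda>y\<in>carrier Y. y)"
    using g by (auto simp: compose_def restrict_def)
  ultimately show ?thesis using f unfolding Inn_iso_def by blast
qed

section \<open>Harmonic and homology maps of a morphism\<close>

lemma homology_map_extensional:
  "homology_map V W f \<in> extensional (carrier (homology_space V))"
  by (simp add: homology_map_def)

lemma harmonic_map_extensional: "harmonic_map V W f \<in> extensional (harmonic V)"
  by (simp add: harmonic_map_def)

locale dgi_morphism = dom: dgi_object V + cod: dgi_object W for V W :: "'a dg_space" +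
  fixes f
  assumes morphism: "f \<in> DGI_hom V W"
begin

lemma linear: "linear_map real_field V W f"
  using morphism by (simp add: DGI_hom_def)

lemma closed: "x \<in> carrier V \<Longrightarrow> f x \<in> carrier W"
  using linear by (rule linear_map_closed)

lemma add: "\<lbrakk>x \<in> carrier V; y \<in> carrier V\<rbrakk> \<Longrightarrow> f (x \<oplus>\<^bsub>V\<^esub> y) = f x \<oplus>\<^bsub>W\<^esub> f y"
  and smult: "x \<in> carrier V \<Longrightarrow> f (r \<odot>\<^bsub>V\<^esub> x) = r \<odot>\<^bsub>W\<^esub> f x"
  and minus: "\<lbrakk>x \<in> carrier V; y \<in> carrier V\<rbrakk> \<Longrightarrow> f (x \<ominus>\<^bsub>V\<^esub> y) = f x \<ominus>\<^bsub>W\<^esub> f y"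
  and zero: "f \<zero>\<^bsub>V\<^esub> = \<zero>\<^bsub>W\<^esub>"
proof -
  interpret linear_map real_field V W f by (rule linear)
  show "\<lbrakk>x \<in> carrier V; y \<in> carrier V\<rbrakk> \<Longrightarrow> f (x \<oplus>\<^bsub>V\<^esub> y) = f x \<oplus>\<^bsub>W\<^esub> f y"
    "x \<in> carrier V \<Longrightarrow> f (r \<odot>\<^bsub>V\<^esub> x) = r \<odot>\<^bsub>W\<^esub> f x"
    "\<lbrakk>x \<in> carrier V; y \<in> carrier V\<rbrakk> \<Longrightarrow> f (x \<ominus>\<^bsub>V\<^esub> y) = f x \<ominus>\<^bsub>W\<^esub> f y"
    "f \<zero>\<^bsub>V\<^esub> = \<zero>\<^bsub>W\<^esub>"
    by simp_all
qed

lemma chain_map: "x \<in> carrier V \<Longrightarrow> f (diff V x) = diff W (f x)"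
  using morphism by (simp add: DGI_hom_def)

lemma cycles: "z \<in> cycles V \<Longrightarrow> f z \<in> cycles W"
  using chain_map[of z] zero closed[of z] by (simp add: cycles_def)

lemma boundaries: "b \<in> boundaries V \<Longrightarrow> f b \<in> boundaries W"
  using chain_map closed by (force simp: boundaries_def)

lemma homology_map_class:
  assumes "z \<in> cycles V"
  shows "homology_map V W f (homology_class V z) = homology_class W (f z)"
proof -
  have z: "z \<in> carrier V" using assms dom.cycles_subset by blast
  have "homology_class W (f z) = homology_class W (f y)"
    if "y \<in> carrier V" "z \<ominus>\<^bsub>V\<^esub> y \<in> boundaries V" for y
    using that z boundaries[OF that(2)] closed
    by (simp add: cod.homology_class_eq_iff minus)
  then show ?thesis
    using assms dom.the_elem_homology_class[OF z, of "\<lambda>z. homology_class W (f z)"]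
    by (simp add: homology_map_def dom.homology_carrier)
qed

lemma harmonic_map_eq:
  assumes "x \<in> harmonic V"
  shows "harmonic_map V W f x = harmonic_representative W (homology_class W (f x))"
  using assms cod.orthogonal_projection_harmonic[OF cycles, of x] dom.harmonic_subset_cycles
  by (auto simp: harmonic_map_def)

lemma harmonic_map_closed: "x \<in> harmonic V \<Longrightarrow> harmonic_map V W f x \<in> harmonic W"
  using cod.harmonic_representative(1)[OF cycles] dom.harmonic_subset_cycles
  by (auto simp: harmonic_map_eq)

text \<open>Naturality of $z \mapsto [z]$: the harmonic projection of $f(x)$ is homologous to $f(x)$.\<close>

lemma homology_class_harmonic_map:
  assumes "x \<in> harmonic V"
  shows "homology_class W (harmonic_map V W f x) = homology_map V W f (homology_class V x)"
  using assms cod.harmonic_representative(2)[OF cycles, of x] homology_map_class[of x]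
    dom.harmonic_subset_cycles
  by (auto simp: harmonic_map_eq)

lemma homology_map_in_Inn_hom:
  "homology_map V W f \<in> Inn_hom (homology_space V) (homology_space W)"
proof (rule Inn_homI[OF dom.inner_product_space_homology cod.inner_product_space_homology])
  show "homology_map V W f \<in> extensional (carrier (homology_space V))"
    by (rule homology_map_extensional)
  show "homology_map V W f X \<in> carrier (homology_space W)"
    if "X \<in> carrier (homology_space V)" for X
    using that cycles by (auto simp: dom.homology_carrier cod.homology_carrier homology_map_class)
  fix X assume "X \<in> carrier (homology_space V)"
  then obtain x where x: "x \<in> cycles V" "X = homology_class V x"
    by (auto simp: dom.homology_carrier)
  then have xc: "x \<in> carrier V" using dom.cycles_subset by blast
  show "homology_map V W f (r \<odot>\<^bsub>homology_space V\<^esub> X) = r \<odot>\<^bsub>homology_space W\<^esub> homology_map V W f X"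
    for r
  proof -
    have "r \<odot>\<^bsub>V\<^esub> x \<in> cycles V"
      using submodule.smult_closed[OF dom.cycles_submodule _ x(1)] by simp
    then show ?thesis
      using x xc closed
      by (simp add: dom.homology_smult cod.homology_smult homology_map_class smult)
  qed
  fix Y assume "Y \<in> carrier (homology_space V)"
  then obtain y where y: "y \<in> cycles V" "Y = homology_class V y"
    by (auto simp: dom.homology_carrier)
  then have yc: "y \<in> carrier V" using dom.cycles_subset by blast
  have "x \<oplus>\<^bsub>V\<^esub> y \<in> cycles V"
    using submodule.m_closed[OF dom.cycles_submodule x(1) y(1)] .
  then show "homology_map V W f (X \<oplus>\<^bsub>homology_space V\<^esub> Y)
      = homology_map V W f X \<oplus>\<^bsub>homology_space W\<^esub> homology_map V W f Y"
    using x xc y yc closed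
    by (simp add: dom.homology_add cod.homology_add homology_map_class add)
qed

text \<open>For linearity, both sides of each equation are harmonic, so it suffices to compare their classes, and there
  the harmonic map becomes the homology map, which is linear.\<close>

lemma harmonic_map_in_Inn_hom:
  "harmonic_map V W f \<in> Inn_hom (harmonic_space V) (harmonic_space W)"
proof (rule Inn_homI[OF dom.inner_product_space_harmonic cod.inner_product_space_harmonic])
  show "harmonic_map V W f \<in> extensional (carrier (harmonic_space V))"
    by (simp add: harmonic_map_extensional)
  show "harmonic_map V W f x \<in> carrier (harmonic_space W)"
    if "x \<in> carrier (harmonic_space V)" for x
    using that harmonic_map_closed by simp
  have eqI: "h = k" if "h \<in> harmonic W" "k \<in> harmonic W" "homology_class W h = homology_class W k"
    for h k
    using that cod.harmonic_representative_eqI by metis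
  fix x assume "x \<in> carrier (harmonic_space V)"
  then have x: "x \<in> harmonic V" "homology_class V x \<in> carrier (homology_space V)"
    by (simp_all add: dom.homology_carrier_harmonic)
  then have xc: "x \<in> carrier V" "harmonic_map V W f x \<in> carrier W"
    using dom.harmonic_subset cod.harmonic_subset harmonic_map_closed by blast+
  show "harmonic_map V W f (r \<odot>\<^bsub>harmonic_space V\<^esub> x) = r \<odot>\<^bsub>harmonic_space W\<^esub> harmonic_map V W f x"
    for r
  proof -
    have "r \<odot>\<^bsub>V\<^esub> x \<in> harmonic V" "r \<odot>\<^bsub>W\<^esub> harmonic_map V W f x \<in> harmonic W"
      using submodule.smult_closed[OF dom.harmonic_submodule _ x(1)]
        submodule.smult_closed[OF cod.harmonic_submodule _ harmonic_map_closed[OF x(1)]]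
      by simp_all
    then show ?thesis
      using x xc harmonic_map_closed Inn_homD(3)[OF homology_map_in_Inn_hom x(2), of r]
      by (intro eqI) (simp_all add: homology_class_harmonic_map dom.homology_smult
          flip: cod.homology_smult)
  qed
  fix y assume "y \<in> carrier (harmonic_space V)"
  then have y: "y \<in> harmonic V" "homology_class V y \<in> carrier (homology_space V)"
    by (simp_all add: dom.homology_carrier_harmonic)
  then have yc: "y \<in> carrier V" "harmonic_map V W f y \<in> carrier W"
    using dom.harmonic_subset cod.harmonic_subset harmonic_map_closed by blast+
  have "x \<oplus>\<^bsub>V\<^esub> y \<in> harmonic V" "harmonic_map V W f x \<oplus>\<^bsub>W\<^esub> harmonic_map V W f y \<in> harmonic W"
    using submodule.m_closed[OF dom.harmonic_submodule x(1) y(1)]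
      submodule.m_closed[OF cod.harmonic_submodule harmonic_map_closed[OF x(1)]
        harmonic_map_closed[OF y(1)]] .
  then show "harmonic_map V W f (x \<oplus>\<^bsub>harmonic_space V\<^esub> y)
      = harmonic_map V W f x \<oplus>\<^bsub>harmonic_space W\<^esub> harmonic_map V W f y"
    using x xc y yc harmonic_map_closed Inn_homD(2)[OF homology_map_in_Inn_hom x(2) y(2)]
    by (intro eqI) (simp_all add: homology_class_harmonic_map dom.homology_add
        flip: cod.homology_add)
qed

end

section \<open>Functoriality and naturality\<close>

lemma dgi_object_if_Ob: "V \<in> Ob DGI \<Longrightarrow> dgi_object V"
  by (simp add: DGI_def dgi_object_def)

lemma dgi_morphism_if_Hom:
  "\<lbrakk>V \<in> Ob DGI; W \<in> Ob DGI; f \<in> Hom DGI V W\<rbrakk> \<Longrightarrow> dgi_morphism V W f"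
  by (simp add: DGI_def dgi_object_def dgi_morphism_def dgi_morphism_axioms_def)

lemma is_functor_homology: "is_functor DGI INN homology_functor"
proof (intro is_functor.intro category_DGI category_INN is_functor_axioms.intro)
  fix U V W :: "'a dg_space" and f g :: "'a \<Rightarrow> 'a"
  show "omap homology_functor V \<in> Ob INN" if "V \<in> Ob DGI"
    using dgi_object.inner_product_space_homology[OF dgi_object_if_Ob[OF that]]
    by (simp add: homology_functor_def INN_def)
  show "fmap homology_functor V W f \<in> Hom INN (omap homology_functor V) (omap homology_functor W)"
    if "V \<in> Ob DGI" "W \<in> Ob DGI" "f \<in> Hom DGI V W"
    using dgi_morphism.homology_map_in_Inn_hom[OF dgi_morphism_if_Hom[OF that]]
    by (simp add: homology_functor_def INN_def)
  show "fmap homology_functor V V (Id DGI V) = Id INN (omap homology_functor V)"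
    if V: "V \<in> Ob DGI"
  proof -
    interpret dgi_morphism V V "Id DGI V"
      using V category.Id_in_Hom[OF category_DGI V] by (intro dgi_morphism_if_Hom)
    have "Id DGI V x = x" if "x \<in> cycles V" for x
      using that dom.cycles_subset by (auto simp: DGI_def)
    then have "homology_map V V (Id DGI V) X = X" if "X \<in> carrier (homology_space V)" for X
      using that by (auto simp: dom.homology_carrier homology_map_class)
    then have "homology_map V V (Id DGI V) = (\<lambda>X\<in>carrier (homology_space V). X)"
      by (intro extensionalityI[OF homology_map_extensional]) simp_all
    then show ?thesis
      by (simp add: homology_functor_def INN_def)
  qed
  show "fmap homology_functor U W (Comp DGI U V W g f)
      = Comp INN (omap homology_functor U) (omap homology_functor V) (omap homology_functor W)
          (fmap homology_functor V W g) (fmap homology_functor U V f)"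
    if UVW: "U \<in> Ob DGI" "V \<in> Ob DGI" "W \<in> Ob DGI" and f: "f \<in> Hom DGI U V"
      and g: "g \<in> Hom DGI V W"
  proof -
    interpret f: dgi_morphism U V f using UVW f by (intro dgi_morphism_if_Hom)
    interpret g: dgi_morphism V W g using UVW g by (intro dgi_morphism_if_Hom)
    interpret gf: dgi_morphism U W "Comp DGI U V W g f"
      using UVW category.Comp_in_Hom[OF category_DGI UVW f g] by (intro dgi_morphism_if_Hom)
    have "homology_map U W (Comp DGI U V W g f) X = homology_map V W g (homology_map U V f X)"
      if X: "X \<in> carrier (homology_space U)" for X
    proof -
      obtain x where x: "x \<in> cycles U" "X = homology_class U x"
        using X by (auto simp: f.dom.homology_carrier)
      then have "Comp DGI U V W g f x = g (f x)"
        using f.dom.cycles_subset by (auto simp: DGI_def compose_def)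
      then show ?thesis
        using x f.cycles by (simp add: f.homology_map_class g.homology_map_class gf.homology_map_class)
    qed
    then have "homology_map U W (Comp DGI U V W g f)
        = compose (carrier (homology_space U)) (homology_map V W g) (homology_map U V f)"
      by (intro extensionalityI[OF homology_map_extensional]) (simp_all add: compose_eq)
    then show ?thesis
      by (simp add: homology_functor_def INN_def)
  qed
qed

text \<open>$h(g)(h(f)(x))$ and $h(gf)(x)$ are harmonic elements of the same class $[g(f(x))]$.\<close>

lemma is_functor_harmonic: "is_functor DGI INN harmonic_functor"
proof (intro is_functor.intro category_DGI category_INN is_functor_axioms.intro)
  fix U V W :: "'a dg_space" and f g :: "'a \<Rightarrow> 'a"
  show "omap harmonic_functor V \<in> Ob INN" if "V \<in> Ob DGI"
    using dgi_object.inner_product_space_harmonic[OF dgi_object_if_Ob[OF that]]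
    by (simp add: harmonic_functor_def INN_def)
  show "fmap harmonic_functor V W f \<in> Hom INN (omap harmonic_functor V) (omap harmonic_functor W)"
    if "V \<in> Ob DGI" "W \<in> Ob DGI" "f \<in> Hom DGI V W"
    using dgi_morphism.harmonic_map_in_Inn_hom[OF dgi_morphism_if_Hom[OF that]]
    by (simp add: harmonic_functor_def INN_def)
  show "fmap harmonic_functor V V (Id DGI V) = Id INN (omap harmonic_functor V)"
    if V: "V \<in> Ob DGI"
  proof -
    interpret dgi_morphism V V "Id DGI V"
      using V category.Id_in_Hom[OF category_DGI V] by (intro dgi_morphism_if_Hom)
    have "Id DGI V x = x" if "x \<in> harmonic V" for x
      using that dom.harmonic_subset by (auto simp: DGI_def)
    then have "harmonic_map V V (Id DGI V) x = x" if "x \<in> harmonic V" for x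
      using that by (simp add: harmonic_map_eq dom.harmonic_representative_eqI)
    then have "harmonic_map V V (Id DGI V) = (\<lambda>x\<in>harmonic V. x)"
      by (intro extensionalityI[OF harmonic_map_extensional]) simp_all
    then show ?thesis
      by (simp add: harmonic_functor_def INN_def)
  qed
  show "fmap harmonic_functor U W (Comp DGI U V W g f)
      = Comp INN (omap harmonic_functor U) (omap harmonic_functor V) (omap harmonic_functor W)
          (fmap harmonic_functor V W g) (fmap harmonic_functor U V f)"
    if UVW: "U \<in> Ob DGI" "V \<in> Ob DGI" "W \<in> Ob DGI" and f: "f \<in> Hom DGI U V"
      and g: "g \<in> Hom DGI V W"
  proof -
    interpret f: dgi_morphism U V f using UVW f by (intro dgi_morphism_if_Hom)
    interpret g: dgi_morphism V W g using UVW g by (intro dgi_morphism_if_Hom)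
    interpret gf: dgi_morphism U W "Comp DGI U V W g f"
      using UVW category.Comp_in_Hom[OF category_DGI UVW f g] by (intro dgi_morphism_if_Hom)
    have "harmonic_map U W (Comp DGI U V W g f) x = harmonic_map V W g (harmonic_map U V f x)"
      if x: "x \<in> harmonic U" for x
    proof -
      have fx: "harmonic_map U V f x \<in> harmonic V" and z: "x \<in> cycles U"
        using x f.harmonic_map_closed f.dom.harmonic_subset_cycles by auto
      have "homology_class W (harmonic_map V W g (harmonic_map U V f x))
          = homology_map V W g (homology_class V (f x))"
        using x fx z by (simp add: g.homology_class_harmonic_map f.homology_class_harmonic_map
            f.homology_map_class)
      also have "\<dots> = homology_class W (g (f x))"
        using z f.cycles by (simp add: g.homology_map_class)
      also have "g (f x) = Comp DGI U V W g f x"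
        using z f.dom.cycles_subset by (auto simp: DGI_def compose_def)
      finally show ?thesis
        using g.harmonic_map_closed[OF fx] gf.harmonic_map_eq[OF x]
          g.cod.harmonic_representative_eqI by metis
    qed
    then have "harmonic_map U W (Comp DGI U V W g f)
        = compose (harmonic U) (harmonic_map V W g) (harmonic_map U V f)"
      by (intro extensionalityI[OF harmonic_map_extensional]) (simp_all add: compose_eq)
    then show ?thesis
      by (simp add: harmonic_functor_def INN_def)
  qed
qed

theorem natural_iso_harmonic_homology:
  "Inn_natural_iso DGI harmonic_functor homology_functor
     (\<lambda>V. restrict (homology_class V) (harmonic V))"
proof -
  have iso: "Inn_iso (harmonic_space V) (homology_space V) (restrict (homology_class V) (harmonic V))"
    if "V \<in> Ob DGI" for V :: "'a dg_space"
  proof -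
    interpret dgi_object V using that by (rule dgi_object_if_Ob)
    show ?thesis
    proof (intro Inn_iso_if_bij_betw Inn_homI inner_product_space_harmonic
        inner_product_space_homology)
      fix x assume "x \<in> carrier (harmonic_space V)"
      then have x: "x \<in> harmonic V" "x \<in> carrier V" using harmonic_subset by auto
      show "restrict (homology_class V) (harmonic V) (r \<odot>\<^bsub>harmonic_space V\<^esub> x)
          = r \<odot>\<^bsub>homology_space V\<^esub> restrict (homology_class V) (harmonic V) x" for r
        using x submodule.smult_closed[OF harmonic_submodule _ x(1), of r]
        by (simp add: homology_smult)
      fix y assume "y \<in> carrier (harmonic_space V)"
      then have y: "y \<in> harmonic V" "y \<in> carrier V" using harmonic_subset by auto
      show "restrict (homology_class V) (harmonic V) (x \<oplus>\<^bsub>harmonic_space V\<^esub> y)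
          = restrict (homology_class V) (harmonic V) x
            \<oplus>\<^bsub>homology_space V\<^esub> restrict (homology_class V) (harmonic V) y"
        using x y submodule.m_closed[OF harmonic_submodule x(1) y(1)]
        by (simp add: homology_add)
    next
      show "bij_betw (restrict (homology_class V) (harmonic V)) (carrier (harmonic_space V))
          (carrier (homology_space V))"
        using bij_betw_homology_class by (simp add: bij_betw_def inj_on_def)
    qed (auto simp: homology_carrier_harmonic)
  qed
  have natural: "compose (harmonic V) (restrict (homology_class W) (harmonic W)) (harmonic_map V W f)
      = compose (harmonic V) (homology_map V W f) (restrict (homology_class V) (harmonic V))"
    if "V \<in> Ob DGI" "W \<in> Ob DGI" "f \<in> Hom DGI V W" for V W :: "'a dg_space" and f
  proof -
    interpret dgi_morphism V W f using that by (rule dgi_morphism_if_Hom)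
    show ?thesis
      unfolding compose_def
      by (rule restrict_ext) (simp add: harmonic_map_closed homology_class_harmonic_map)
  qed
  show ?thesis
    unfolding Inn_natural_iso_def
    by (intro conjI ballI is_functor_harmonic is_functor_homology)
      (simp_all add: harmonic_functor_def homology_functor_def iso natural
        dgi_object.harmonic_space_simps(1)[OF dgi_object_if_Ob])
qed

lemma is_functor_comp:
  assumes "is_functor C D F" "is_functor D E G"
  shows "is_functor C E (G \<circ>\<^sub>F F)"
proof -
  interpret F: is_functor C D F by fact
  interpret G: is_functor D E G by fact
  show ?thesis
    by unfold_locales (simp_all add: functor_comp_def F.omap_in_Ob F.fmap_in_Hom F.fmap_Id F.fmap_Comp
        G.omap_in_Ob G.fmap_in_Hom G.fmap_Id G.fmap_Comp)
qed

lemma Inn_natural_iso_whisker: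
  assumes "Inn_natural_iso D F G \<eta>" "is_functor C D S"
  shows "Inn_natural_iso C (F \<circ>\<^sub>F S) (G \<circ>\<^sub>F S) (\<lambda>a. \<eta> (omap S a))"
proof -
  interpret S: is_functor C D S by fact
  show ?thesis
    using assms is_functor_comp[OF assms(2), of INN F] is_functor_comp[OF assms(2), of INN G]
      S.omap_in_Ob S.fmap_in_Hom
    by (simp add: Inn_natural_iso_def functor_comp_def)
qed

theorem theorem1p1:
  fixes S :: "(real, unit, 'a dg_space, 'a \<Rightarrow> 'a) functor_data"
  assumes "is_functor real_poset DGI S"
  shows "\<exists>\<eta>. Inn_natural_iso real_poset (harmonic_functor \<circ>\<^sub>F S) (homology_functor \<circ>\<^sub>F S) \<eta>"
  using Inn_natural_iso_whisker[OF natural_iso_harmonic_homology assms] by blast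

end
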